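(* Let $j\in\mathcal J$ and let $\theta_j\in\{d_j,\sigma_j\}$ be the free scalar parameter, all other model parameters being held fixed. Assume the local regularity condition at a reference value $\bar\theta_j$, with neighborhood $\mathcal T$ (see context). Then, for $\theta_j\in\mathcal T$, the local optimal value $V_j^*$ is locally increasing in $\theta_j$, i.e. $\frac{\partial V_j^*}{\partial\theta_j}>0$ (both for $\theta_j=d_j$ and for $\theta_j=\sigma_j$).
   Context: $\mathcal I,\mathcal J$ are finite index sets, $b>0$, $\mathcal X=\{x\in\{0,1\}^{|\mathcal I|}:\sum_{i\in\mathcal I} x_i\le p\}$, $\mathcal N=[0,b]^{|\mathcal J|}$. The objective is $$F(x,n)=e+d^\top n+r^\top x+\sum_{j\in\mathcal J}f_j(x,n_j),\qquad f_j(x,n_j)=h_j(n_j;\sigma_j)\sum_{i\in\mathcal I}q_{ij}\Psi\!\left(\frac{g_{ij}(x)}{h_j(n_j;\sigma_j)}\right),$$ with $e\in\mathbb R$, $d\in\mathbb R^{|\mathcal J|}$ (sampling costs), $r\in\mathbb R^{|\mathcal I|}$, $q_{ij}>0$, each $g_{ij}$ an affine function of $x$, and $\Psi(z)=z\Phi(z)+\phi(z)$, where $\Phi,\phi$ are the standard normal cdf and pdf. Standing assumption on the standard deviations $h_j$: (i) $h_j(\cdot;\sigma_j)$ is finite, positive, strictly convex, decreasing and continuously differentiable on $[0,\infty)$ for any $\sigma_j$; (ii) $\frac{\partial h_j}{\partial\sigma_j}(n_j;\sigma_j)>0$ for all $n_j\ge0$; (iii) $\frac{\partial^2h_j}{\partial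 n_j\partial\sigma_j}(n_j;\sigma_j)<0$ for all $n_j\ge0$. A point $(x^*,n^* )\in\mathcal X\times\mathcal N$ is a (blockwise) local minimizer of $F$ if $x^*\in\arg\min_{x\in\mathcal X}F(x,n^* )$ and there is $\epsilon>0$ with $F(x^*,n^* )\le F(x^*,n)$ for all $n\in\mathcal N$ with $\|n-n^*\|<\epsilon$. Local regularity condition: for the reference value $\bar\theta_j$, $(x^*(\bar\theta_j),n^*(\bar\theta_j))$ is a local minimizer of $F$ over $\mathcal X\times\mathcal N$, and there is an open neighborhood $\mathcal T$ of $\bar\theta_j$ such that for every $\theta_j\in\mathcal T$ the corresponding local minimizer $(x^*(\theta_j),n^*(\theta_j))$ of $F$ over $\mathcal X\times\mathcal N$ satisfies $x^*(\theta_j)=x^*(\bar\theta_j)$ and $n^*(\theta_j)\in(0,b)^{|\mathcal J|}$. $\theta_j\mapsto n_j^*(\theta_j)$ denotes the resulting differentiable local solution mapping on $\mathcal T$ of the one-dimensional problem $\min_{0\le n_j\le b}\{\varphi_j(n_j;\theta_j):=d_jn_j+f_j(x,n_j)\}$ with $x=x^*(\bar\theta_j)$, and $V_j^*(\theta_j):=\varphi_j(n_j^*(\theta_j);\theta_j)$ is the resulting differentiable local optimal value function. *)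

theory Defs
  imports "HOL-Probability.Probability"
begin

definition Psi :: "real \<Rightarrow> real" where
  "Psi z = z * cdf std_normal_distribution z + std_normal_density z"

definition affine_function :: "('a::real_inner \<Rightarrow> real) \<Rightarrow> bool" where
  "affine_function f \<longleftrightarrow> (\<exists>a c. \<forall>x. f x = a \<bullet> x + c)"

definition strictly_convex_on :: "real set \<Rightarrow> (real \<Rightarrow> real) \<Rightarrow> bool" where
  "strictly_convex_on S f \<longleftrightarrow> convex S \<and>
     (\<forall>x\<in>S. \<forall>y\<in>S. x \<noteq> y \<longrightarrow>
        (\<forall>u. 0 < u \<and> u < 1 \<longrightarrow> f ((1 - u) * x + u * y) < (1 - u) * f x + u * f y))"

text \<open>
  The index types \<open>'i\<close> and \<open>'j\<close> play the roles of the (nonempty) finite index sets \<open>I\<close> and \<open>J\<close>.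
  The standard deviation \<open>h\<^sub>j(n; s)\<close> is \<open>std M j n s\<close>; it is only relevant for \<open>n \<ge> 0\<close> and
  for \<open>s\<close> in the set \<open>sig_dom M j\<close> of admissible values of the parameter \<open>\<sigma>\<^sub>j\<close>, for instance
  all reals or the positive reals.
\<close>

record ('i::finite, 'j::finite) sampling_model =
  constant_cost :: real
  sampling_cost :: "real ^ 'j"
  location_cost :: "real ^ 'i"
  weight :: "'i \<Rightarrow> 'j \<Rightarrow> real"
  gfun :: "'i \<Rightarrow> 'j \<Rightarrow> real ^ 'i \<Rightarrow> real"
  std :: "'j \<Rightarrow> real \<Rightarrow> real \<Rightarrow> real"
  sig :: "real ^ 'j"
  sig_dom :: "'j \<Rightarrow> real set"
  card_bound :: real
  sample_bound :: real

definition X_set :: "('i::finite, 'j::finite) sampling_model \<Rightarrow> (real ^ 'i) set" where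
  "X_set M = {x. (\<forall>i. x $ i \<in> {0, 1}) \<and> (\<Sum>i\<in>UNIV. x $ i) \<le> card_bound M}"

definition N_set :: "('i::finite, 'j::finite) sampling_model \<Rightarrow> (real ^ 'j) set" where
  "N_set M = {n. \<forall>j. n $ j \<in> {0..sample_bound M}}"

definition f_term ::
  "('i::finite, 'j::finite) sampling_model \<Rightarrow> 'j \<Rightarrow> real ^ 'i \<Rightarrow> real \<Rightarrow> real" where
  "f_term M j x m =
     std M j m (sig M $ j) *
       (\<Sum>i\<in>UNIV. weight M i j * Psi (gfun M i j x / std M j m (sig M $ j)))"

definition objective ::
  "('i::finite, 'j::finite) sampling_model \<Rightarrow> real ^ 'i \<Rightarrow> real ^ 'j \<Rightarrow> real" where
  "objective M x n =
     constant_cost M + sampling_cost M \<bullet> n + location_cost M \<bullet> x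
       + (\<Sum>j\<in>UNIV. f_term M j x (n $ j))"

definition phi_term ::
  "('i::finite, 'j::finite) sampling_model \<Rightarrow> 'j \<Rightarrow> real ^ 'i \<Rightarrow> real \<Rightarrow> real" where
  "phi_term M j x m = sampling_cost M $ j * m + f_term M j x m"

text \<open>
  Derivatives with respect to the sample size are taken within \<open>[0, \<infinity>)\<close>, hence one-sided at \<open>0\<close>.
  Below, \<open>hs\<close> and \<open>hns\<close> are \<open>\<partial>h/\<partial>\<sigma>\<close> and \<open>\<partial>\<^sup>2h/\<partial>n\<partial>\<sigma> = \<partial>/\<partial>n (\<partial>h/\<partial>\<sigma>)\<close>.
\<close>

definition std_assumption :: "real set \<Rightarrow> (real \<Rightarrow> real \<Rightarrow> real) \<Rightarrow> bool" where
  "std_assumption S h \<longleftrightarrow>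
     (\<forall>s\<in>S.
        (\<forall>n\<ge>0. 0 < h n s) \<and>
        strictly_convex_on {0..} (\<lambda>n. h n s) \<and>
        antimono_on {0..} (\<lambda>n. h n s) \<and>
        (\<exists>hn. continuous_on {0..} hn \<and>
           (\<forall>n\<ge>0. ((\<lambda>m. h m s) has_real_derivative hn n) (at n within {0..})))) \<and>
     (\<exists>hs hns. \<forall>s\<in>S. \<forall>n\<ge>0.
        ((\<lambda>t. h n t) has_real_derivative hs n s) (at s) \<and> hs n s > 0 \<and>
        ((\<lambda>m. hs m s) has_real_derivative hns n s) (at n within {0..}) \<and> hns n s < 0)"

definition valid_model :: "('i::finite, 'j::finite) sampling_model \<Rightarrow> bool" where
  "valid_model M \<longleftrightarrow>
     sample_bound M > 0 \<and>
     (\<forall>i j. weight M i j > 0) \<and>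
     (\<forall>i j. affine_function (gfun M i j)) \<and>
     (\<forall>j. open (sig_dom M j) \<and> sig M $ j \<in> sig_dom M j \<and>
          std_assumption (sig_dom M j) (std M j))"

definition local_minimizer ::
  "('i::finite, 'j::finite) sampling_model \<Rightarrow> real ^ 'i \<Rightarrow> real ^ 'j \<Rightarrow> bool" where
  "local_minimizer M x n \<longleftrightarrow>
     x \<in> X_set M \<and> n \<in> N_set M \<and>
     is_arg_min (\<lambda>y. objective M y n) (\<lambda>y. y \<in> X_set M) x \<and>
     (\<exists>\<epsilon>>0. \<forall>m\<in>N_set M. norm (m - n) < \<epsilon> \<longrightarrow> objective M x n \<le> objective M x m)"

datatype free_param = Cost | Sigma

definition vec_update :: "real ^ 'j \<Rightarrow> 'j::finite \<Rightarrow> real \<Rightarrow> real ^ 'j" where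
  "vec_update v j t = (\<chi> k. if k = j then t else v $ k)"

fun set_param ::
  "free_param \<Rightarrow> 'j \<Rightarrow> real \<Rightarrow> ('i::finite, 'j::finite) sampling_model \<Rightarrow> ('i, 'j) sampling_model"
where
  "set_param Cost j t M = M\<lparr>sampling_cost := vec_update (sampling_cost M) j t\<rparr>"
| "set_param Sigma j t M = M\<lparr>sig := vec_update (sig M) j t\<rparr>"

fun param_dom ::
  "free_param \<Rightarrow> 'j \<Rightarrow> ('i::finite, 'j::finite) sampling_model \<Rightarrow> real set" where
  "param_dom Cost j M = UNIV"
| "param_dom Sigma j M = sig_dom M j"

text \<open>
  In \<open>local_regularity p j M T tb xs ns\<close> the own value of the free parameter in \<open>M\<close> is irrelevant:
  it is overwritten by \<open>t\<close>. The maps \<open>xs\<close> and \<open>ns\<close> are the selected local minimizers as functions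
  of the free parameter, and \<open>tb\<close> is the reference value.
\<close>

definition local_regularity ::
  "free_param \<Rightarrow> 'j \<Rightarrow> ('i::finite, 'j::finite) sampling_model \<Rightarrow> real set \<Rightarrow> real \<Rightarrow>
     (real \<Rightarrow> real ^ 'i) \<Rightarrow> (real \<Rightarrow> real ^ 'j) \<Rightarrow> bool" where
  "local_regularity p j M T tb xs ns \<longleftrightarrow>
     open T \<and> tb \<in> T \<and> T \<subseteq> param_dom p j M \<and>
     (\<forall>t\<in>T. local_minimizer (set_param p j t M) (xs t) (ns t) \<and>
             xs t = xs tb \<and> (\<forall>k. ns t $ k \<in> {0<..<sample_bound M}))"

definition local_value ::
  "free_param \<Rightarrow> 'j \<Rightarrow> ('i::finite, 'j::finite) sampling_model \<Rightarrow> real ^ 'i \<Rightarrow>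
     (real \<Rightarrow> real ^ 'j) \<Rightarrow> real \<Rightarrow> real" where
  "local_value p j M x ns t = phi_term (set_param p j t M) j x (ns t $ j)"

end

theory Submission
  imports Defs
begin

text \<open>
  The argument is the envelope theorem. Write \<open>f\<^sub>j = L \<circ> h\<^sub>j\<close> with
  \<open>L y = (\<Sum>i. q\<^sub>i\<^sub>j * y * Psi (g\<^sub>i\<^sub>j / y))\<close>, so that \<open>n\<^sub>j\<close> and \<open>\<sigma>\<^sub>j\<close> enter only through the standard
  deviation \<open>h\<^sub>j\<close>. Each summand is the perspective of \<open>Psi\<close>; since \<open>Psi' = \<Phi>\<close>, its derivative
  \<open>Psi z - z * \<Phi> z\<close> at \<open>z = g / y\<close> collapses to the density \<open>\<phi> z\<close>, hence \<open>L' > 0\<close>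
  (\<open>loss_has_real_derivative\<close>, \<open>loss_slope_pos\<close>): more uncertainty always costs more.

  Differentiating \<open>V = d\<^sub>j * n\<^sup>* + L (h\<^sub>j(n\<^sup>*; \<sigma>\<^sub>j))\<close> along the solution path produces a term with
  the factor \<open>d\<^sub>j + L' * \<partial>h\<^sub>j/\<partial>n\<close>, which vanishes because \<open>n\<^sup>*\<close> is an interior local minimizer
  (\<open>first_order_condition\<close>). What remains is the direct effect of the parameter: \<open>n\<^sup>*\<close> itself,
  positive by interiority, when the parameter is \<open>d\<^sub>j\<close>, and \<open>L' * \<partial>h\<^sub>j/\<partial>\<sigma>\<^sub>j > 0\<close> when it is \<open>\<sigma>\<^sub>j\<close>.

  The delicate point is the chain rule for \<open>t \<mapsto> h\<^sub>j(n\<^sup>*(t); t)\<close> in the second case. Only partial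
  derivatives of \<open>h\<^sub>j\<close> are given, and joint differentiability is not among the hypotheses. The negative
  mixed partial derivative supplies the missing uniformity: it makes the difference quotients of
  \<open>h\<^sub>j\<close> in \<open>\<sigma>\<close> decreasing in \<open>n\<close>, so that the quotient at the moving point \<open>n\<^sup>*(t)\<close> is squeezed
  between quotients at fixed points on either side (\<open>difference_quotient_along_curve_tendsto\<close>).
\<close>

section \<open>The standard normal loss function and its perspective\<close>

lemma cdf_std_normal_has_real_derivative:
  "(cdf std_normal_distribution has_real_derivative std_normal_density z) (at z)"
proof -
  interpret real_distribution std_normal_distribution
    by (rule real_dist_normal_dist)
  let ?a = "z - 1" and ?b = "z + 1"
  have increment: "cdf std_normal_distribution u
      = cdf std_normal_distribution ?a + (LBINT y=?a..u. std_normal_density y)"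
    if "u \<in> {?a<..<?b}" for u
  proof -
    have u: "?a < u" using that by simp
    have "measure std_normal_distribution {?a<..u}
        = (LINT y|std_normal_distribution. indicator {?a<..u} y)"
      by simp
    also have "\<dots> = (LINT y|lborel. std_normal_density y * indicator {?a<..u} y)"
      by (subst integral_real_density) auto
    also have "\<dots> = (LBINT y=?a..u. std_normal_density y)"
      using u by (simp add: interval_integral_Ioc set_lebesgue_integral_def mult.commute)
    finally show ?thesis using cdf_diff_eq[OF u] by simp
  qed
  \<comment> \<open>The base point \<open>z - 1\<close> lies below \<open>z\<close>, so the fundamental theorem of calculus on
    \<open>[z - 1, z + 1]\<close> gives a two-sided derivative at \<open>z\<close>.\<close>
  have "continuous_on {?a..?b} std_normal_density"
    unfolding std_normal_density_def by (intro continuous_intros) auto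
  then have "((\<lambda>u. LBINT y=?a..u. std_normal_density y) has_vector_derivative std_normal_density z)
      (at z within {?a..?b})"
    by (intro interval_integral_FTC2) auto
  moreover have "at z within {?a..?b} = at z"
    by (rule at_within_interior) simp
  ultimately have "((\<lambda>u. LBINT y=?a..u. std_normal_density y) has_real_derivative
      std_normal_density z) (at z)"
    by (simp add: has_real_derivative_iff_has_vector_derivative)
  then have "((\<lambda>u. cdf std_normal_distribution ?a + (LBINT y=?a..u. std_normal_density y))
      has_real_derivative std_normal_density z) (at z)"
    by (auto intro!: derivative_eq_intros)
  then show ?thesis
    by (rule has_field_derivative_transform_within_open[where S = "{?a<..<?b}"])
      (simp_all add: increment)
qed

text \<open>
  The density satisfies \<open>\<phi>' z = - z * \<phi> z\<close>, which cancels the term \<open>z * \<Phi>' z\<close> of the product rule.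
\<close>

lemma Psi_has_real_derivative:
  "(Psi has_real_derivative cdf std_normal_distribution z) (at z)"
proof -
  have "(std_normal_density has_real_derivative - z * std_normal_density z) (at z)"
    unfolding std_normal_density_def
    by (rule DERIV_cmult[THEN DERIV_cong]) (auto intro!: derivative_eq_intros)
  then have "((\<lambda>z. z * cdf std_normal_distribution z + std_normal_density z)
      has_real_derivative cdf std_normal_distribution z) (at z)"
    by (auto intro!: derivative_eq_intros cdf_std_normal_has_real_derivative)
  then show ?thesis
    unfolding Psi_def[abs_def] .
qed

text \<open>
  The derivative of a perspective \<open>y * Psi (g / y)\<close> is \<open>Psi z - z * Psi' z\<close> at \<open>z = g / y\<close>; with
  \<open>Psi' = \<Phi>\<close> only the density survives. This is why the expected loss increases with the standard
  deviation for either sign of \<open>g\<close>.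
\<close>

lemma perspective_Psi_has_real_derivative:
  assumes "y > 0"
  shows "((\<lambda>y. y * Psi (g / y)) has_real_derivative std_normal_density (g / y)) (at y)"
proof -
  have "((\<lambda>y. Psi (g / y)) has_real_derivative
      cdf std_normal_distribution (g / y) * (- g / y\<^sup>2)) (at y)"
    using assms
    by (intro DERIV_chain2[OF Psi_has_real_derivative])
      (auto intro!: derivative_eq_intros simp: power2_eq_square)
  then have "((\<lambda>y. y * Psi (g / y)) has_real_derivative
      Psi (g / y) + y * (cdf std_normal_distribution (g / y) * (- g / y\<^sup>2))) (at y)"
    by (auto intro!: derivative_eq_intros)
  moreover have "Psi (g / y) + y * (cdf std_normal_distribution (g / y) * (- g / y\<^sup>2))
      = std_normal_density (g / y)"
    using assms by (simp add: Psi_def power2_eq_square)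
  ultimately show ?thesis by simp
qed

text \<open>
  This is \<open>f_term\<close> with the standard deviation \<open>y\<close> as the argument in place of \<open>n\<^sub>j\<close> and \<open>\<sigma>\<^sub>j\<close>.
\<close>

definition loss :: "('i::finite, 'j::finite) sampling_model \<Rightarrow> 'j \<Rightarrow> real ^ 'i \<Rightarrow> real \<Rightarrow> real" where
  "loss M j x y = y * (\<Sum>i\<in>UNIV. weight M i j * Psi (gfun M i j x / y))"

definition loss_slope ::
  "('i::finite, 'j::finite) sampling_model \<Rightarrow> 'j \<Rightarrow> real ^ 'i \<Rightarrow> real \<Rightarrow> real" where
  "loss_slope M j x y = (\<Sum>i\<in>UNIV. weight M i j * std_normal_density (gfun M i j x / y))"

lemma loss_has_real_derivative:
  assumes "y > 0"
  shows "(loss M j x has_real_derivative loss_slope M j x y) (at y)"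
proof -
  have "loss M j x = (\<lambda>y. \<Sum>i\<in>UNIV. weight M i j * (y * Psi (gfun M i j x / y)))"
    by (simp add: loss_def fun_eq_iff sum_distrib_left mult.left_commute)
  then show ?thesis
    unfolding loss_slope_def using assms
    by (auto intro!: DERIV_sum DERIV_cmult perspective_Psi_has_real_derivative)
qed

lemma loss_slope_pos:
  assumes "\<And>i. weight M i j > 0"
  shows "loss_slope M j x y > 0"
  unfolding loss_slope_def
  by (intro sum_pos mult_pos_pos assms normal_density_pos) auto

section \<open>The first-order condition in one coordinate\<close>

text \<open>
  The objective is separable in \<open>n\<close>, so a move in a single coordinate changes only its own
  one-dimensional objective. This reduces local minimality in \<open>n\<close> to that of \<open>phi_term\<close>.
\<close>

lemma objective_vec_update:
  fixes M :: "('i::finite, 'j::finite) sampling_model" and j :: 'j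
  shows "objective M x (vec_update n j m)
      = objective M x n - phi_term M j x (n $ j) + phi_term M j x m"
proof -
  have "(\<Sum>k\<in>UNIV. g k (vec_update n j m $ k))
      = (\<Sum>k\<in>UNIV. g k (n $ k)) - g j (n $ j) + g j m" for g :: "'j \<Rightarrow> real \<Rightarrow> real"
    by (simp add: sum.remove[of UNIV j] vec_update_def)
  from this[of "\<lambda>k u. sampling_cost M $ k * u"] this[of "\<lambda>k. f_term M k x"]
  show ?thesis
    by (simp add: objective_def phi_term_def inner_vec_def)
qed

lemma local_minimizer_phi_term:
  assumes min: "local_minimizer M x n"
    and interior: "n $ j \<in> {0<..<sample_bound M}"
  shows "\<exists>\<delta>>0. \<forall>m. \<bar>n $ j - m\<bar> < \<delta> \<longrightarrow> phi_term M j x (n $ j) \<le> phi_term M j x m"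
proof -
  obtain \<epsilon> where \<epsilon>: "\<epsilon> > 0" "n \<in> N_set M"
      "\<And>m. m \<in> N_set M \<Longrightarrow> norm (m - n) < \<epsilon> \<Longrightarrow> objective M x n \<le> objective M x m"
    using min unfolding local_minimizer_def by blast
  \<comment> \<open>The two distances to the ends of \<open>[0, b]\<close> keep the perturbed point feasible.\<close>
  define \<delta> where "\<delta> = min \<epsilon> (min (n $ j) (sample_bound M - n $ j))"
  have "phi_term M j x (n $ j) \<le> phi_term M j x m" if m: "\<bar>n $ j - m\<bar> < \<delta>" for m
  proof -
    have "vec_update n j m - n = (m - n $ j) *\<^sub>R axis j 1"
      by (simp add: vec_eq_iff vec_update_def axis_def)
    then have "norm (vec_update n j m - n) < \<epsilon>"
      using m by (simp add: \<delta>_def abs_minus_commute)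
    moreover have "vec_update n j m \<in> N_set M"
      using \<epsilon>(2) m by (auto simp: N_set_def vec_update_def \<delta>_def)
    ultimately show ?thesis
      using \<epsilon>(3)[of "vec_update n j m"] by (simp add: objective_vec_update)
  qed
  moreover have "\<delta> > 0" using \<epsilon>(1) interior by (simp add: \<delta>_def)
  ultimately show ?thesis by blast
qed

lemma first_order_condition:
  assumes "local_minimizer M x n" "n $ j \<in> {0<..<sample_bound M}"
    and "std M j (n $ j) (sig M $ j) > 0"
    and "((\<lambda>m. std M j m (sig M $ j)) has_real_derivative hn) (at (n $ j))"
  shows "sampling_cost M $ j + loss_slope M j x (std M j (n $ j) (sig M $ j)) * hn = 0"
proof -
  have "phi_term M j x = (\<lambda>m. sampling_cost M $ j * m + loss M j x (std M j m (sig M $ j)))"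
    by (simp add: phi_term_def f_term_def loss_def fun_eq_iff)
  then have "(phi_term M j x has_real_derivative
      sampling_cost M $ j + loss_slope M j x (std M j (n $ j) (sig M $ j)) * hn) (at (n $ j))"
    by (auto intro!: derivative_eq_intros DERIV_chain2[OF loss_has_real_derivative] assms)
  with local_minimizer_phi_term[OF assms(1,2)] show ?thesis
    using DERIV_local_min by blast
qed

section \<open>A chain rule from monotone partial derivatives\<close>

text \<open>
  If \<open>\<partial>h/\<partial>s\<close> decreases in \<open>n\<close>, then for \<open>n1 \<le> n2\<close> the gap \<open>h n2 s - h n1 s\<close> has a nonpositive
  derivative in \<open>s\<close>. Its being nonincreasing is the claim, with both signs of \<open>t - t0\<close> at once.
\<close>

lemma difference_quotient_antimono:
  fixes h hs :: "real \<Rightarrow> real \<Rightarrow> real"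
  assumes der: "\<And>n s. n \<in> N \<Longrightarrow> s \<in> S \<Longrightarrow> (h n has_real_derivative hs n s) (at s)"
    and anti: "\<And>s. s \<in> S \<Longrightarrow> antimono_on N (\<lambda>n. hs n s)"
    and S: "is_interval S" "t \<in> S" "t0 \<in> S" "t \<noteq> t0"
    and n: "n1 \<in> N" "n2 \<in> N" "n1 \<le> n2"
  shows "(h n2 t - h n2 t0) / (t - t0) \<le> (h n1 t - h n1 t0) / (t - t0)"
proof -
  have gap: "h n2 v - h n1 v \<le> h n2 u - h n1 u" if "u \<in> S" "v \<in> S" "u \<le> v" for u v
  proof (rule DERIV_nonpos_imp_nonincreasing[OF \<open>u \<le> v\<close>])
    fix s assume "u \<le> s" "s \<le> v"
    then have "s \<in> S" using that S(1) unfolding is_interval_1 by blast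
    then have "((\<lambda>s. h n2 s - h n1 s) has_real_derivative hs n2 s - hs n1 s) (at s)"
      using n by (intro DERIV_diff der)
    moreover have "hs n2 s - hs n1 s \<le> 0"
      using anti[OF \<open>s \<in> S\<close>] n by (simp add: monotone_on_def)
    ultimately show "\<exists>D. ((\<lambda>s. h n2 s - h n1 s) has_real_derivative D) (at s) \<and> D \<le> 0"
      by blast
  qed
  show ?thesis
  proof (cases "t > t0")
    case True
    then show ?thesis using gap[of t0 t] S by (intro divide_right_mono) auto
  next
    case False
    then show ?thesis using gap[of t t0] S by (intro divide_right_mono_neg) auto
  qed
qed

text \<open>
  A squeeze takes the place of uniform convergence. For fixed \<open>n1 < \<nu> t0 < n2\<close> the quotient at
  \<open>\<nu> t\<close> eventually lies between those at \<open>n2\<close> and \<open>n1\<close>, which tend to \<open>hs n2 t0\<close> and \<open>hs n1 t0\<close>;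
  by continuity of \<open>hs\<close> in its first argument these limits are as close to \<open>hs (\<nu> t0) t0\<close> as desired.
\<close>

lemma difference_quotient_along_curve_tendsto:
  fixes h hs :: "real \<Rightarrow> real \<Rightarrow> real" and \<nu> :: "real \<Rightarrow> real"
  assumes der: "\<And>n s. n \<in> N \<Longrightarrow> s \<in> S \<Longrightarrow> (h n has_real_derivative hs n s) (at s)"
    and anti: "\<And>s. s \<in> S \<Longrightarrow> antimono_on N (\<lambda>n. hs n s)"
    and S: "open S" "t0 \<in> S" and N: "open N" "\<nu> t0 \<in> N"
    and cont: "isCont (\<lambda>n. hs n t0) (\<nu> t0)" "isCont \<nu> t0"
  shows "((\<lambda>t. (h (\<nu> t) t - h (\<nu> t) t0) / (t - t0)) \<longlongrightarrow> hs (\<nu> t0) t0) (at t0)"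
proof -
  define q where "q n t = (h n t - h n t0) / (t - t0)" for n t
  obtain e where e: "e > 0" "ball t0 e \<subseteq> S"
    using S openE by blast
  have near: "\<forall>\<^sub>F t in at t0. t \<in> ball t0 e \<and> t \<noteq> t0"
    using e(1) eventually_at_in_open[of "ball t0 e" t0]
    by (simp add: eventually_at_filter)
  have q_anti: "q n2 t \<le> q n1 t"
    if "t \<in> ball t0 e" "t \<noteq> t0" "n1 \<in> N" "n2 \<in> N" "n1 \<le> n2" for n1 n2 t
    unfolding q_def
    by (rule difference_quotient_antimono[where N = N and S = "ball t0 e" and hs = hs])
      (use that e der anti in \<open>auto simp: is_interval_ball_real\<close>)
  have q_lim: "(q n \<longlongrightarrow> hs n t0) (at t0)" if "n \<in> N" for n
    using der[OF that S(2)] unfolding q_def[abs_def]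
    by (simp add: has_field_derivative_iff)
  have \<nu>_lim: "(\<nu> \<longlongrightarrow> \<nu> t0) (at t0)"
    using cont(2) by (simp add: isCont_def)
  then have \<nu>_N: "\<forall>\<^sub>F t in at t0. \<nu> t \<in> N"
    using N topological_tendstoD by blast
  have hs_lim: "((\<lambda>n. hs n t0) \<longlongrightarrow> hs (\<nu> t0) t0) (at (\<nu> t0))"
    using cont(1) by (simp add: isCont_def)
  have N_near: "\<forall>\<^sub>F n in at (\<nu> t0). n \<in> N"
    using N eventually_at_in_open' by blast
  have "((\<lambda>t. q (\<nu> t) t) \<longlongrightarrow> hs (\<nu> t0) t0) (at t0)"
  proof (rule order_tendstoI)
    fix a assume a: "a < hs (\<nu> t0) t0"
    have ev: "\<forall>\<^sub>F n in at_right (\<nu> t0). a < hs n t0 \<and> n \<in> N \<and> \<nu> t0 < n"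
      using order_tendstoD(1)[OF tendsto_within_subset[OF hs_lim subset_UNIV] a]
        N_near[unfolded eventually_at_split, THEN conjunct2] eventually_at_right_less
      by eventually_elim simp
    obtain n where n: "a < hs n t0" "n \<in> N" "\<nu> t0 < n"
      using eventually_happens'[OF trivial_limit_at_right_real ev] by blast
    show "\<forall>\<^sub>F t in at t0. a < q (\<nu> t) t"
      using order_tendstoD(1)[OF q_lim[OF n(2)] n(1)] order_tendstoD(2)[OF \<nu>_lim n(3)] \<nu>_N near
      proof eventually_elim
      case (elim t)
      then have "q n t \<le> q (\<nu> t) t" using q_anti[of t "\<nu> t" n] n(2) by simp
      then show ?case using elim(1) by simp
    qed
  next
    fix a assume a: "hs (\<nu> t0) t0 < a"
    have "\<forall>\<^sub>F n in at_left (\<nu> t0). n < \<nu> t0"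
      by (simp add: eventually_at_filter)
    then have ev: "\<forall>\<^sub>F n in at_left (\<nu> t0). hs n t0 < a \<and> n \<in> N \<and> n < \<nu> t0"
      using order_tendstoD(2)[OF tendsto_within_subset[OF hs_lim subset_UNIV] a]
        N_near[unfolded eventually_at_split, THEN conjunct1]
      by eventually_elim simp
    obtain n where n: "hs n t0 < a" "n \<in> N" "n < \<nu> t0"
      using eventually_happens'[OF trivial_limit_at_left_real ev] by blast
    show "\<forall>\<^sub>F t in at t0. q (\<nu> t) t < a"
      using order_tendstoD(2)[OF q_lim[OF n(2)] n(1)] order_tendstoD(1)[OF \<nu>_lim n(3)] \<nu>_N near
      proof eventually_elim
      case (elim t)
      then have "q (\<nu> t) t \<le> q n t" using q_anti[of t n "\<nu> t"] n(2) by simp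
      then show ?case using elim(1) by simp
    qed
  qed
  then show ?thesis unfolding q_def .
qed

text \<open>
  The increment from \<open>(\<nu> t0, t0)\<close> to \<open>(\<nu> t, t)\<close> is split at \<open>(\<nu> t, t0)\<close>. The first leg varies only
  \<open>n\<close> at the fixed parameter \<open>t0\<close> and is covered by the ordinary chain rule; the second is the
  difference quotient at a moving point treated above.
\<close>

lemma has_real_derivative_along_curve:
  fixes h hs :: "real \<Rightarrow> real \<Rightarrow> real" and \<nu> :: "real \<Rightarrow> real"
  assumes der: "\<And>n s. n \<in> N \<Longrightarrow> s \<in> S \<Longrightarrow> (h n has_real_derivative hs n s) (at s)"
    and anti: "\<And>s. s \<in> S \<Longrightarrow> antimono_on N (\<lambda>n. hs n s)"
    and S: "open S" "t0 \<in> S" and N: "open N" "\<nu> t0 \<in> N"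
    and cont: "isCont (\<lambda>n. hs n t0) (\<nu> t0)"
    and hn: "((\<lambda>n. h n t0) has_real_derivative hn) (at (\<nu> t0))"
    and \<nu>: "(\<nu> has_real_derivative \<nu>') (at t0)"
  shows "((\<lambda>t. h (\<nu> t) t) has_real_derivative hs (\<nu> t0) t0 + hn * \<nu>') (at t0)"
proof -
  have "((\<lambda>t. (h (\<nu> t) t - h (\<nu> t) t0) / (t - t0)) \<longlongrightarrow> hs (\<nu> t0) t0) (at t0)"
    using difference_quotient_along_curve_tendsto[OF der anti S N cont DERIV_isCont[OF \<nu>]] .
  moreover have "((\<lambda>t. (h (\<nu> t) t0 - h (\<nu> t0) t0) / (t - t0)) \<longlongrightarrow> hn * \<nu>') (at t0)"
    using DERIV_chain2[OF hn \<nu>] by (simp add: has_field_derivative_iff)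
  ultimately have "((\<lambda>t. (h (\<nu> t) t - h (\<nu> t) t0) / (t - t0)
        + (h (\<nu> t) t0 - h (\<nu> t0) t0) / (t - t0)) \<longlongrightarrow> hs (\<nu> t0) t0 + hn * \<nu>') (at t0)"
    by (rule tendsto_add)
  then show ?thesis
    by (simp add: has_field_derivative_iff add_divide_distrib[symmetric])
qed

text \<open>
  At \<open>n > 0\<close> the derivatives within \<open>[0, \<infinity>)\<close> are two-sided, and the negative mixed derivative
  makes \<open>\<partial>h/\<partial>s\<close> decreasing in \<open>n\<close>, as the chain rule above requires.
\<close>

lemma std_assumption_has_real_derivative_along_curve:
  fixes h :: "real \<Rightarrow> real \<Rightarrow> real"
  assumes "std_assumption S h" "open S"
  obtains hn hs where
    "\<And>n s. n > 0 \<Longrightarrow> s \<in> S \<Longrightarrow> ((\<lambda>m. h m s) has_real_derivative hn n s) (at n)"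
    "\<And>n s. n > 0 \<Longrightarrow> s \<in> S \<Longrightarrow> hs n s > 0"
    "\<And>\<nu> \<nu>' t. \<nu> t > 0 \<Longrightarrow> t \<in> S \<Longrightarrow> (\<nu> has_real_derivative \<nu>') (at t) \<Longrightarrow>
      ((\<lambda>t. h (\<nu> t) t) has_real_derivative hs (\<nu> t) t + hn (\<nu> t) t * \<nu>') (at t)"
proof -
  have at_eq: "at n within {0..} = at n" if "n > 0" for n :: real
    using that by (intro at_within_interior) simp
  have "\<forall>s\<in>S. \<exists>hn. \<forall>n\<ge>0. ((\<lambda>m. h m s) has_real_derivative hn n) (at n within {0..})"
    using assms(1) unfolding std_assumption_def by blast
  then obtain hn where
    "\<And>s n. s \<in> S \<Longrightarrow> n \<ge> 0 \<Longrightarrow> ((\<lambda>m. h m s) has_real_derivative hn s n) (at n within {0..})"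
    by metis
  then have hn: "((\<lambda>m. h m s) has_real_derivative hn s n) (at n)" if "n > 0" "s \<in> S" for n s
    using that at_eq by (metis less_imp_le)
  obtain hs hns where all: "\<forall>s\<in>S. \<forall>n\<ge>0.
      (h n has_real_derivative hs n s) (at s) \<and> hs n s > 0 \<and>
      ((\<lambda>m. hs m s) has_real_derivative hns n s) (at n within {0..}) \<and> hns n s < 0"
    using assms(1) unfolding std_assumption_def by blast
  have hs: "(h n has_real_derivative hs n s) (at s)" "hs n s > 0"
      "((\<lambda>m. hs m s) has_real_derivative hns n s) (at n within {0..})" "hns n s < 0"
    if "s \<in> S" "n \<ge> 0" for s n
    using all that by blast+
  have hns: "((\<lambda>m. hs m s) has_real_derivative hns n s) (at n)" if "n > 0" "s \<in> S" for n s
    using hs(3) that at_eq by (metis less_imp_le)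
  have anti: "antimono_on {0<..} (\<lambda>n. hs n s)" if s: "s \<in> S" for s
  proof (rule monotone_onI)
    fix n1 n2 :: real assume n: "n1 \<in> {0<..}" "n2 \<in> {0<..}" "n1 \<le> n2"
    show "hs n2 s \<le> hs n1 s"
    proof (rule DERIV_nonpos_imp_nonincreasing[OF n(3)])
      fix m assume "n1 \<le> m" "m \<le> n2"
      then have "m > 0" using n by simp
      then show "\<exists>D. ((\<lambda>n. hs n s) has_real_derivative D) (at m) \<and> D \<le> 0"
        using hns[OF _ s] hs(4)[OF s] by (meson less_imp_le)
    qed
  qed
  show ?thesis
  proof (rule that[of "\<lambda>n s. hn s n" hs])
    fix \<nu> :: "real \<Rightarrow> real" and \<nu>' t
    assume *: "\<nu> t > 0" "t \<in> S" "(\<nu> has_real_derivative \<nu>') (at t)"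
    show "((\<lambda>t. h (\<nu> t) t) has_real_derivative hs (\<nu> t) t + hn t (\<nu> t) * \<nu>') (at t)"
    proof (rule has_real_derivative_along_curve[where h = h and hs = hs and \<nu> = \<nu>
          and N = "{0<..}" and S = S])
      show "isCont (\<lambda>n. hs n t) (\<nu> t)" "((\<lambda>n. h n t) has_real_derivative hn t (\<nu> t)) (at (\<nu> t))"
        using DERIV_isCont hns hn *(1,2) by blast+
      show "(h n has_real_derivative hs n s) (at s)" if "n \<in> {0<..}" "s \<in> S" for n s
        using hs(1) that by simp
    qed (use * anti assms(2) in simp_all)
  qed (use hn hs(2) in auto)
qed

section \<open>Monotonicity of the local optimal value\<close>

theorem theorem2:
  fixes M :: "('i::finite, 'j::finite) sampling_model"
    and j :: 'j
    and p :: free_param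
    and T :: "real set"
    and \<theta>bar :: real
    and xs :: "real \<Rightarrow> real ^ 'i"
    and ns :: "real \<Rightarrow> real ^ 'j"
  assumes "valid_model M"
    and "local_regularity p j M T \<theta>bar xs ns"
    and "(\<lambda>\<theta>. ns \<theta> $ j) differentiable_on T"
  shows "\<forall>\<theta>\<in>T. local_value p j M (xs \<theta>bar) ns differentiable (at \<theta>) \<and>
                 deriv (local_value p j M (xs \<theta>bar) ns) \<theta> > 0"
proof
  fix \<theta> assume \<theta>: "\<theta> \<in> T"
  define x \<nu> h S where defs: "x = xs \<theta>bar" "\<nu> = (\<lambda>\<theta>. ns \<theta> $ j)" "h = std M j" "S = sig_dom M j"
  have model: "std_assumption S h" "open S" "sig M $ j \<in> S" "\<And>i. weight M i j > 0"
    using assms(1) by (auto simp: valid_model_def defs)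
  have h_pos: "h n s > 0" if "n > 0" "s \<in> S" for n s
    using model(1) that by (simp add: std_assumption_def)
  have T: "open T" "T \<subseteq> param_dom p j M"
    and min: "local_minimizer (set_param p j \<theta> M) x (ns \<theta>)"
    and interior: "ns \<theta> $ j \<in> {0<..<sample_bound M}"
    using assms(2) \<theta> unfolding local_regularity_def defs by metis+
  have \<nu>_pos: "\<nu> \<theta> > 0" using interior by (simp add: defs)
  have "(\<nu> differentiable (at \<theta>))"
    using assms(3) \<theta> T(1) by (simp add: differentiable_on_eq_differentiable_at defs)
  then obtain \<nu>' where \<nu>': "(\<nu> has_real_derivative \<nu>') (at \<theta>)"
    using real_differentiable_def by blast
  obtain hn hs where
    hn: "\<And>n s. n > 0 \<Longrightarrow> s \<in> S \<Longrightarrow> ((\<lambda>m. h m s) has_real_derivative hn n s) (at n)" and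
    hs: "\<And>n s. n > 0 \<Longrightarrow> s \<in> S \<Longrightarrow> hs n s > 0" and
    curve: "\<And>\<nu> \<nu>' t. \<nu> t > 0 \<Longrightarrow> t \<in> S \<Longrightarrow> (\<nu> has_real_derivative \<nu>') (at t) \<Longrightarrow>
      ((\<lambda>t. h (\<nu> t) t) has_real_derivative hs (\<nu> t) t + hn (\<nu> t) t * \<nu>') (at t)"
    using std_assumption_has_real_derivative_along_curve[OF model(1,2)] by blast
  have "\<exists>D>0. (local_value p j M x ns has_real_derivative D) (at \<theta>)"
  proof (cases p)
    case Cost
    let ?s = "sig M $ j" and ?L = "loss_slope M j x (h (\<nu> \<theta>) (sig M $ j))"
    have "((\<lambda>t. h (\<nu> t) ?s) has_real_derivative hn (\<nu> \<theta>) ?s * \<nu>') (at \<theta>)"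
      by (rule DERIV_chain2[OF hn[OF \<nu>_pos model(3)] \<nu>'])
    note loss_der = DERIV_chain2[OF loss_has_real_derivative[OF h_pos[OF \<nu>_pos model(3)],
        where M = M and j = j and x = x] this]
    have "local_value p j M x ns = (\<lambda>t. t * \<nu> t + loss M j x (h (\<nu> t) ?s))"
      by (simp add: fun_eq_iff Cost local_value_def phi_term_def f_term_def loss_def vec_update_def defs)
    then have "(local_value p j M x ns has_real_derivative
        \<nu> \<theta> + \<theta> * \<nu>' + ?L * (hn (\<nu> \<theta>) ?s * \<nu>')) (at \<theta>)"
      using DERIV_add[OF DERIV_mult[OF DERIV_ident \<nu>'] loss_der] by (simp add: mult.commute)
    moreover have "\<theta> + ?L * hn (\<nu> \<theta>) ?s = 0"
      using first_order_condition[OF min, of j "hn (\<nu> \<theta>) ?s"] interior \<nu>_pos model(3)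
        h_pos[OF \<nu>_pos model(3)] hn[OF \<nu>_pos model(3)]
      by (simp add: Cost defs vec_update_def loss_slope_def)
    \<comment> \<open>Envelope step: the first-order condition removes every term that contains \<open>\<nu>'\<close>.\<close>
    then have "\<nu> \<theta> + \<theta> * \<nu>' + ?L * (hn (\<nu> \<theta>) ?s * \<nu>') = \<nu> \<theta>"
      by algebra
    ultimately show ?thesis using \<nu>_pos by auto
  next
    case Sigma
    let ?d = "sampling_cost M $ j" and ?L = "loss_slope M j x (h (\<nu> \<theta>) \<theta>)"
    have \<theta>S: "\<theta> \<in> S" using \<theta> T(2) by (auto simp: Sigma defs)
    note loss_der = DERIV_chain2[OF loss_has_real_derivative[OF h_pos[OF \<nu>_pos \<theta>S],
        where M = M and j = j and x = x] curve[OF \<nu>_pos \<theta>S \<nu>']]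
    have "local_value p j M x ns = (\<lambda>t. ?d * \<nu> t + loss M j x (h (\<nu> t) t))"
      by (simp add: fun_eq_iff Sigma local_value_def phi_term_def f_term_def loss_def vec_update_def defs)
    then have "(local_value p j M x ns has_real_derivative
        ?d * \<nu>' + ?L * (hs (\<nu> \<theta>) \<theta> + hn (\<nu> \<theta>) \<theta> * \<nu>')) (at \<theta>)"
      using DERIV_add[OF DERIV_cmult[OF \<nu>'] loss_der] by simp
    moreover have "?d + ?L * hn (\<nu> \<theta>) \<theta> = 0"
      using first_order_condition[OF min, of j "hn (\<nu> \<theta>) \<theta>"] interior
        h_pos[OF \<nu>_pos \<theta>S] hn[OF \<nu>_pos \<theta>S]
      by (simp add: Sigma defs vec_update_def loss_slope_def)
    \<comment> \<open>As before, the terms with \<open>\<nu>'\<close> vanish; here the direct effect of \<open>\<sigma>\<^sub>j\<close> on \<open>h\<close> remains.\<close>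
    then have "?d * \<nu>' + ?L * (hs (\<nu> \<theta>) \<theta> + hn (\<nu> \<theta>) \<theta> * \<nu>') = ?L * hs (\<nu> \<theta>) \<theta>"
      by algebra
    moreover have "?L * hs (\<nu> \<theta>) \<theta> > 0"
      by (intro mult_pos_pos loss_slope_pos model(4) hs \<nu>_pos \<theta>S)
    ultimately show ?thesis by auto
  qed
  then obtain D where "D > 0" "(local_value p j M x ns has_real_derivative D) (at \<theta>)"
    by blast
  then show "local_value p j M (xs \<theta>bar) ns differentiable (at \<theta>) \<and>
      deriv (local_value p j M (xs \<theta>bar) ns) \<theta> > 0"
    using DERIV_imp_deriv real_differentiable_def by (auto simp: defs)
qed

end
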